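(* Let $t\ge 2$ and $s\ge t$ be integers. Form $G$ from an even cycle $C_{2t}$ by identifying one vertex of the cycle with an endpoint of a path having $s-t+1$ edges. Let $x_t$ be the resulting $3$-vertex and let $x_0$ be the vertex of the cycle farthest from $x_t$; then $x_0$ and $x_t$ split the cycle into two paths $P_1$ and $P_2$. Label the internal vertices of $P_1$, in order from $x_0$ to $x_t$, as $x'_1,x'_2,\ldots,x'_{t-1}$, and the internal vertices of $P_2$, in order from $x_0$ to $x_t$, as $x''_1,x''_2,\ldots,x''_{t-1}$. Call the $1$-vertex $r$, and let $P_3$ be the path from $x_t$ to $r$. Label the internal vertices of $P_3$, in order from $x_t$ to $r$, as $x_{t+1},x_{t+2},\ldots,x_s$. Give weight $2^i$ to $x'_i$ and $x''_i$ for each $1\le i\le t-1$, and weight $2^i$ to $x_i$ for each $t\le i\le s$. Give weight $\alpha=\frac{2^s+2^{t-1}-2}{2^s-1}$ to $x_0$ and weight $0$ to $r$. Let $w$ be the resulting weight vector indexed by $V(G)$. If $p$ is an $r$-unsolvable configuration on $G$, then $w\cdot p\le w\cdot \mathbf{1}_G$.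
   Context: A $k$-vertex is a vertex of degree $k$. A configuration on a graph $G$ is a function $p:V(G)\to\mathbb{N}\cup\{0\}$ (number of pebbles on each vertex), regarded as a vector indexed by $V(G)$. A pebbling move removes two pebbles from some vertex and places one pebble on an adjacent vertex. A configuration is $r$-unsolvable if no (possibly empty) sequence of pebbling moves starting from it yields a configuration with at least one pebble on $r$. $\mathbf{1}_G$ is the vector on $V(G)$ with every entry $1$, and $\cdot$ is the dot product. *)

theory Defs
  imports Complex_Main "Graph_Theory.Pair_Digraph"
begin

text \<open>
  Undirected simple graphs are represented, as in the library, by pair digraphs with a
  symmetric loop-free arc relation (locale \<^locale>\<open>pair_graph\<close>): an edge between
  \<open>u\<close> and \<open>v\<close> is the pair of arcs \<open>(u, v)\<close>, \<open>(v, u)\<close>, so the degree of a vertex is its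
  \<^const>\<open>out_degree\<close>.
\<close>

definition path_graph :: "'v list \<Rightarrow> 'v pair_pre_digraph" where
  "path_graph vs = \<lparr>pverts = set vs, parcs = symcl (set (zip vs (tl vs)))\<rparr>"

text \<open>As \<^const>\<open>path_graph\<close>, with an additional edge from the last vertex back to the first.\<close>

definition cycle_graph :: "'v list \<Rightarrow> 'v pair_pre_digraph" where
  "cycle_graph vs = \<lparr>pverts = set vs, parcs = symcl (set (zip vs (rotate1 vs)))\<rparr>"

text \<open>
  For two graphs with exactly one common vertex, this is the graph obtained by
  identifying the two copies of that vertex.
\<close>

definition graph_union ::
  "'v pair_pre_digraph \<Rightarrow> 'v pair_pre_digraph \<Rightarrow> 'v pair_pre_digraph" where
  "graph_union G H = \<lparr>pverts = pverts G \<union> pverts H, parcs = parcs G \<union> parcs H\<rparr>"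

lemma symcl_iff: "(u, v) \<in> symcl R \<longleftrightarrow> (u, v) \<in> R \<or> (v, u) \<in> R"
  by (auto simp: symcl_def)

lemma pair_graph_of_list:
  assumes "R \<subseteq> set vs \<times> set vs" "\<And>u. (u, u) \<notin> R"
  shows "pair_graph \<lparr>pverts = set vs, parcs = symcl R\<rparr>"
proof -
  have "finite R"
    using assms(1) by (rule finite_subset) simp
  then have "finite (symcl R)"
    by (simp add: symcl_def)
  then show ?thesis
    using assms by unfold_locales (auto simp: symcl_iff symmetric_def intro!: symI)
qed

lemma pair_graph_path_graph:
  assumes "distinct vs"
  shows "pair_graph (path_graph vs)"
  unfolding path_graph_def
proof (rule pair_graph_of_list)
  show "set (zip vs (tl vs)) \<subseteq> set vs \<times> set vs"
    by (cases vs) (auto dest: set_zip_leftD set_zip_rightD)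
  show "(u, u) \<notin> set (zip vs (tl vs))" for u
    using assms by (auto simp: in_set_zip nth_tl nth_eq_iff_index_eq)
qed

lemma pair_graph_cycle_graph:
  assumes "distinct vs" "length vs \<ge> 2"
  shows "pair_graph (cycle_graph vs)"
  unfolding cycle_graph_def
proof (rule pair_graph_of_list)
  show "set (zip vs (rotate1 vs)) \<subseteq> set vs \<times> set vs"
    by (auto dest: set_zip_leftD set_zip_rightD)
  show "(u, u) \<notin> set (zip vs (rotate1 vs))" for u
  proof
    assume "(u, u) \<in> set (zip vs (rotate1 vs))"
    then obtain i where i: "i < length vs" "vs ! i = vs ! (Suc i mod length vs)"
      by (auto simp: in_set_zip nth_rotate1)
    moreover have "Suc i mod length vs < length vs"
      using i(1) by (intro mod_less_divisor) linarith
    ultimately have "i = Suc i mod length vs"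
      using assms(1) by (simp add: nth_eq_iff_index_eq)
    then show False
      using i(1) assms(2) by (auto simp: mod_Suc split: if_splits)
  qed
qed

lemma pair_graph_graph_union:
  assumes "pair_graph G" "pair_graph H"
  shows "pair_graph (graph_union G H)"
proof -
  interpret G: pair_graph G by fact
  interpret H: pair_graph H by fact
  show ?thesis
    using G.pair_sym_arcs H.pair_sym_arcs
    by unfold_locales
      (auto simp: graph_union_def symmetric_def sym_Un
        dest: G.wellformed' H.wellformed' G.no_loops' H.no_loops')
qed

text \<open>
  A configuration is a function \<open>p :: 'v \<Rightarrow> nat\<close>; its values outside the vertex set are
  never touched by a move. The graph is assumed loop-free, so \<open>u \<noteq> v\<close> below.
\<close>

inductive pebbling_move :: "'v pair_pre_digraph \<Rightarrow> ('v \<Rightarrow> nat) \<Rightarrow> ('v \<Rightarrow> nat) \<Rightarrow> bool"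
  for G where
  "(u, v) \<in> parcs G \<Longrightarrow> 2 \<le> p u \<Longrightarrow> pebbling_move G p (p(u := p u - 2, v := p v + 1))"

definition unsolvable :: "'v pair_pre_digraph \<Rightarrow> 'v \<Rightarrow> ('v \<Rightarrow> nat) \<Rightarrow> bool" where
  "unsolvable G r p \<longleftrightarrow> \<not> (\<exists>q. (pebbling_move G)\<^sup>*\<^sup>* p q \<and> 1 \<le> q r)"

definition dot :: "'v pair_pre_digraph \<Rightarrow> ('v \<Rightarrow> real) \<Rightarrow> ('v \<Rightarrow> real) \<Rightarrow> real" where
  "dot G f g = (\<Sum>v\<in>pverts G. f v * g v)"

end

theory Submission
  imports Defs
begin

text \<open>
  Weights that double at each step towards the root measure exactly how many pebbles a path
  can deliver: pushing everything greedily along a path \<open>y 0, \<dots>, y n\<close> brings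
  \<open>(\<Sum>i<n. 2 ^ i * p (y i)) div 2 ^ n\<close> new pebbles to \<open>y n\<close>, because the successive
  halvings with rounding combine into a single division
  (\<open>pebbling_moves_along_path\<close>).

  The graph is a lasso: two arms of \<open>h = t - 1\<close> vertices lead from neighbours of \<open>x 0\<close> to
  the junction \<open>x t\<close>, and a tail of \<open>n = s + 1 - t\<close> edges leads from there to \<open>r\<close>. It is
  enough to consider how \<open>K = p (x 0) div 2\<close> pebbles leaving \<open>x 0\<close> are divided between the
  arms. With \<open>U\<close>, \<open>V\<close>, \<open>R\<close> the weighted contents of the arms and of the tail (including
  \<open>x t\<close>), each starting at weight \<open>1\<close>, and \<open>m = 2 ^ h\<close>, \<open>T = 2 ^ n\<close>, unsolvability gives
  \<open>(U + k) div m + (V + l) div m + R < T\<close> whenever \<open>k + l \<le> K\<close>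
  (\<open>unsolvable_lasso\<close>). Since \<open>m * T = 2 ^ s\<close>, we have
  \<open>\<alpha> = 1 + (m - 1) / (m * T - 1)\<close>, and once one \<open>\<alpha>\<close> is used to
  pay for an odd pebble on \<open>x 0\<close>, the weight inequality divided by \<open>2\<close> reads
  \<open>\<alpha> * K + U + V + m * R \<le> m * T + m - 2\<close>.

  This inequality (\<open>two_arms_bound\<close>) follows from a dichotomy. If \<open>K\<close> is large enough to
  complete one arm to a multiple of \<open>m\<close>, then all rounding loss happens on the other arm, so
  \<open>U + V + K + m * R < m * T\<close>; in particular \<open>K \<le> m * T - 1\<close>, so the excess of \<open>\<alpha>\<close> over \<open>1\<close>
  contributes at most \<open>m - 1\<close>, which is the remaining slack. The value of \<open>\<alpha>\<close> is chosen for
  this case, with equality when \<open>2 ^ (s + 1) - 1\<close> pebbles are on \<open>x 0\<close> and none elsewhere.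
  Otherwise the remainders of \<open>U\<close> and \<open>V\<close> modulo \<open>m\<close> are both at most \<open>m - 1 - K\<close>. Each pebble
  leaving \<open>x 0\<close> then lowers the bound on \<open>U + V\<close> by two, and \<open>\<alpha> \<le> 2\<close> suffices.
\<close>

section \<open>Pushing pebbles along paths\<close>

lemma pebbling_moves_along_edge:
  assumes "(u, v) \<in> parcs G" "u \<noteq> v" "2 * k \<le> p u"
  shows "(pebbling_move G)\<^sup>*\<^sup>* p (p(u := p u - 2 * k, v := p v + k))"
  using assms(3)
proof (induction k)
  case 0
  then show ?case by simp
next
  case (Suc k)
  let ?q = "p(u := p u - 2 * k, v := p v + k)"
  have "pebbling_move G ?q (?q(u := ?q u - 2, v := ?q v + 1))"
    using assms(1,2) Suc.prems by (intro pebbling_move.intros) auto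
  also have "?q(u := ?q u - 2, v := ?q v + 1) = p(u := p u - 2 * Suc k, v := p v + Suc k)"
    using assms(2) by (auto simp: fun_eq_iff)
  finally show ?case
    using Suc by (meson Suc_leD mult_le_mono2 le_trans le_SucI order_refl rtranclp.rtrancl_into_rtrancl)
qed

text \<open>
  The step from \<open>n\<close> to \<open>n + 1\<close> moves half of what has gathered on \<open>y n\<close>; nested floors collapse
  by \<open>x div 2 ^ n div 2 = x div 2 ^ Suc n\<close>. The last conjunct lets pushes along different paths
  be performed one after another.
\<close>

lemma pebbling_moves_along_path:
  assumes "\<And>i. i < n \<Longrightarrow> (y i, y (Suc i)) \<in> parcs G" "inj_on y {..n}"
  shows "\<exists>q. (pebbling_move G)\<^sup>*\<^sup>* p q \<and> q (y n) = p (y n) + (\<Sum>i<n. 2 ^ i * p (y i)) div 2 ^ n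
    \<and> (\<forall>v. v \<notin> y ` {..n} \<longrightarrow> q v = p v)"
  using assms
proof (induction n)
  case 0
  show ?case by (rule exI[of _ p]) auto
next
  case (Suc n)
  have "inj_on y {..n}"
    using Suc.prems(2) by (rule inj_on_subset) auto
  with Suc obtain q where q: "(pebbling_move G)\<^sup>*\<^sup>* p q"
    "q (y n) = p (y n) + (\<Sum>i<n. 2 ^ i * p (y i)) div 2 ^ n"
    "\<And>v. v \<notin> y ` {..n} \<Longrightarrow> q v = p v"
    by (metis less_SucI)
  have new: "y (Suc n) \<notin> y ` {..n}"
    using inj_onD[OF Suc.prems(2), of "Suc n"] by force
  then have neq: "y n \<noteq> y (Suc n)" by (metis atMost_iff imageI order_refl)
  let ?k = "q (y n) div 2"
  let ?q' = "q(y n := q (y n) - 2 * ?k, y (Suc n) := q (y (Suc n)) + ?k)"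
  have "(pebbling_move G)\<^sup>*\<^sup>* q ?q'"
    using Suc.prems(1) neq by (intro pebbling_moves_along_edge) auto
  with q(1) have "(pebbling_move G)\<^sup>*\<^sup>* p ?q'" by (rule rtranclp_trans)
  moreover have "?k = (\<Sum>i<Suc n. 2 ^ i * p (y i)) div 2 ^ Suc n"
  proof -
    have "q (y n) = (\<Sum>i<Suc n. 2 ^ i * p (y i)) div 2 ^ n"
      using q(2) by simp
    then show ?thesis
      by (metis div_mult2_eq power_Suc2)
  qed
  then have "?q' (y (Suc n)) = p (y (Suc n)) + (\<Sum>i<Suc n. 2 ^ i * p (y i)) div 2 ^ Suc n"
    using q(3)[OF new] by simp
  moreover have "?q' v = p v" if "v \<notin> y ` {..Suc n}" for v
  proof -
    have "v \<noteq> y n" "v \<noteq> y (Suc n)" "v \<notin> y ` {..n}"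
      using that by auto
    then show ?thesis using q(3) by simp
  qed
  ultimately show ?case by blast
qed

text \<open>
  The vertex \<open>c\<close> sends \<open>k\<close> pebbles into arm \<open>a\<close> and \<open>l\<close> into arm \<open>b\<close>; then both arms are
  pushed to the junction \<open>a h = b h = z 0\<close>, and the junction and the tail are pushed to \<open>z n\<close>.
  The three pushes do not interfere, so the left-hand side is the weighted content of the tail
  before the last push, which would deliver a pebble if this were at least \<open>2 ^ n\<close>.
\<close>

lemma unsolvable_lasso:
  assumes arcs: "(c, a 0) \<in> parcs G" "(c, b 0) \<in> parcs G"
      "\<And>i. i < h \<Longrightarrow> (a i, a (Suc i)) \<in> parcs G" "\<And>i. i < h \<Longrightarrow> (b i, b (Suc i)) \<in> parcs G"
      "\<And>j. j < n \<Longrightarrow> (z j, z (Suc j)) \<in> parcs G"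
    and ends: "a h = z 0" "b h = z 0" "0 < h" "0 < n"
    and inj: "inj_on a {..h}" "inj_on b {..h}" "inj_on z {..n}"
    and c: "c \<notin> a ` {..h}" "c \<notin> b ` {..h}" "c \<notin> z ` {..n}"
    and disj: "a ` {..<h} \<inter> b ` {..h} = {}" "a ` {..<h} \<inter> z ` {..n} = {}"
      "b ` {..<h} \<inter> z ` {..n} = {}"
    and unsolv: "unsolvable G (z n) p"
    and kl: "2 * (k + l) \<le> p c"
  shows "((\<Sum>i<h. 2 ^ i * p (a i)) + k) div 2 ^ h + ((\<Sum>i<h. 2 ^ i * p (b i)) + l) div 2 ^ h
    + (\<Sum>j<n. 2 ^ j * p (z j)) < 2 ^ n"
proof -
  obtain h' where h': "h = Suc h'" using ends(3) by (cases h) auto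
  have shift: "(\<Sum>i<h. 2 ^ i * f i) = (f 0 + (\<Sum>i<h'. 2 ^ Suc i * f (Suc i)) :: nat)" for f
    unfolding h' by (subst sum.lessThan_Suc_shift) simp
  have b_notin: "b i \<notin> a ` {..h}" if "i < h" for i
  proof
    assume "b i \<in> a ` {..h}"
    then obtain j where j: "j \<le> h" "b i = a j" by auto
    show False
    proof (cases "j = h")
      case True
      then show False using j(2) ends inj_onD[OF inj(2), of i h] that by simp
    next
      case False
      then have "a j \<in> a ` {..<h}" "b i \<in> b ` {..h}" using j(1) that by auto
      then show False using j(2) disj(1) by auto
    qed
  qed
  have a0b0: "a 0 \<noteq> b 0" using b_notin[of 0] ends(3) by (metis atMost_iff imageI le0)
  have ca: "c \<noteq> a i" "c \<noteq> b i" if "i \<le> h" for i using c that by auto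
  define p1 where "p1 = p(c := p c - 2 * k, a 0 := p (a 0) + k)"
  define p2 where "p2 = p1(c := p1 c - 2 * l, b 0 := p1 (b 0) + l)"
  have p1: "(pebbling_move G)\<^sup>*\<^sup>* p p1"
    unfolding p1_def using arcs ca[of 0] kl by (intro pebbling_moves_along_edge) auto
  have p2: "(pebbling_move G)\<^sup>*\<^sup>* p1 p2"
    unfolding p2_def using arcs ca[of 0] kl by (intro pebbling_moves_along_edge) (auto simp: p1_def)
  obtain p3 where p3: "(pebbling_move G)\<^sup>*\<^sup>* p2 p3"
    "p3 (a h) = p2 (a h) + (\<Sum>i<h. 2 ^ i * p2 (a i)) div 2 ^ h"
    "\<And>v. v \<notin> a ` {..h} \<Longrightarrow> p3 v = p2 v"
    using pebbling_moves_along_path[OF arcs(3) inj(1)] by blast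
  obtain p4 where p4: "(pebbling_move G)\<^sup>*\<^sup>* p3 p4"
    "p4 (b h) = p3 (b h) + (\<Sum>i<h. 2 ^ i * p3 (b i)) div 2 ^ h"
    "\<And>v. v \<notin> b ` {..h} \<Longrightarrow> p4 v = p3 v"
    using pebbling_moves_along_path[OF arcs(4) inj(2)] by blast
  obtain p5 where p5: "(pebbling_move G)\<^sup>*\<^sup>* p4 p5"
    "p5 (z n) = p4 (z n) + (\<Sum>i<n. 2 ^ i * p4 (z i)) div 2 ^ n"
    using pebbling_moves_along_path[OF arcs(5) inj(3)] by blast
  have "(pebbling_move G)\<^sup>*\<^sup>* p p5"
    using p1 p2 p3(1) p4(1) p5(1) by (meson rtranclp_trans)
  with unsolv have "p5 (z n) = 0"
    by (auto simp: unsolvable_def not_le)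
  with p5(2) have small: "(\<Sum>j<n. 2 ^ j * p4 (z j)) < 2 ^ n"
    by (auto simp: div_eq_0_iff)
  \<comment> \<open>The pebbles sent out by \<open>c\<close> land on the vertices of weight \<open>1\<close>, so they add \<open>k\<close> and \<open>l\<close>
    to the weighted sums of the arms.\<close>
  have p2a: "p2 (a i) = p (a i) + (if i = 0 then k else 0)" if "i < h" for i
    using that ca[of i] ca[of 0] inj(1) disj(1) a0b0
    by (auto simp: p2_def p1_def inj_on_def disjoint_iff)
  have p2b: "p2 (b i) = p (b i) + (if i = 0 then l else 0)" if "i < h" for i
    using that ca[of i] ca[of 0] inj(2) b_notin[of i] a0b0
    by (auto simp: p2_def p1_def inj_on_def)
  have p2z: "p2 (z j) = p (z j)" if "j \<le> n" for j
  proof -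
    have "z j \<noteq> a 0" "z j \<noteq> b 0" "z j \<noteq> c"
      using disj(2,3) c(3) that ends(3) by (auto simp: disjoint_iff)
    then show ?thesis by (simp add: p2_def p1_def)
  qed
  have "p3 (z 0) = p (z 0) + ((\<Sum>i<h. 2 ^ i * p (a i)) + k) div 2 ^ h"
    using p3(2) ends p2z[of 0] unfolding shift by (simp add: p2a h' ac_simps)
  moreover have "(\<Sum>i<h. 2 ^ i * p3 (b i)) = (\<Sum>i<h. 2 ^ i * p (b i)) + l"
    using p3(3)[OF b_notin] unfolding shift by (simp add: p2b h')
  ultimately have root: "p4 (z 0) = p (z 0) + ((\<Sum>i<h. 2 ^ i * p (a i)) + k) div 2 ^ h
      + ((\<Sum>i<h. 2 ^ i * p (b i)) + l) div 2 ^ h"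
    using p4(2) ends by simp
  have rest: "p4 (z j) = p (z j)" if "0 < j" "j \<le> n" for j
  proof -
    have "z j \<noteq> z 0" using inj(3) that by (auto simp: inj_on_def)
    moreover have "{..h} = insert h {..<h}" "z j \<in> z ` {..n}" using that by auto
    ultimately have "z j \<notin> a ` {..h}" "z j \<notin> b ` {..h}"
      using disj(2,3) ends by auto
    then show ?thesis using p3(3) p4(3) p2z that by simp
  qed
  obtain n' where n': "n = Suc n'" using ends(4) by (cases n) auto
  have split_sum: "(\<Sum>j<n. 2 ^ j * f j) = (f 0 + (\<Sum>j<n'. 2 ^ Suc j * f (Suc j)) :: nat)" for f
    unfolding n' by (subst sum.lessThan_Suc_shift) simp
  show ?thesis
    using small root unfolding split_sum by (simp add: rest n')
qed

section \<open>The arithmetic of two arms\<close>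

text \<open>
  Two counters with contents \<open>u\<close> and \<open>v\<close> each lose the remainder modulo \<open>m\<close>, and \<open>k\<close> further
  units can be divided between them to reduce the loss. The right-hand side is
  \<open>m * (T - 1) + 2 * (m - 1)\<close>, so for \<open>k = 0\<close> both remainders may be maximal; the question is how much more than \<open>1\<close> each of the \<open>k\<close> units may
  count. When \<open>k\<close> suffices to remove one of the remainders, less than one remainder is lost and
  the slack \<open>m - 1\<close> can be distributed over the at most \<open>m * T - 1\<close> units.
\<close>

lemma two_arms_bound:
  fixes m k u v R T :: nat
  assumes "1 \<le> m" "2 \<le> T"
    and less: "\<And>b c. b + c \<le> k \<Longrightarrow> (u + b) div m + (v + c) div m + R < T"
  shows "(1 + (real m - 1) / (real m * real T - 1)) * real k + real u + real v + real m * real R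
    \<le> real m * real T + real m - 2"
proof -
  have mT: "2 \<le> real m * real T"
    using assms(1,2) by (metis mult_le_mono mult_1 of_nat_le_iff of_nat_mult of_nat_numeral)
  consider (aligned) b where "b \<le> k" "m dvd u + b \<or> m dvd v + b"
    | (short) "u mod m + k < m" "v mod m + k < m"
  proof -
    have *: "\<exists>b\<le>k. m dvd w + b" if "\<not> w mod m + k < m" for w
    proof (intro exI conjI)
      show "m - w mod m \<le> k" using that by linarith
      have "w + (m - w mod m) = m * (w div m) + m"
        using assms(1) mult_div_mod_eq[of m w] mod_less_divisor[of m w] by linarith
      then show "m dvd w + (m - w mod m)" by simp
    qed
    show ?thesis using *[of u] *[of v] aligned short by blast
  qed
  then show ?thesis
  proof cases
    case aligned
    have "(u + v + k) div m + R < T"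
      using aligned(2)
    proof
      assume d: "m dvd u + b"
      have "(u + b) div m + (v + (k - b)) div m = (u + b + (v + (k - b))) div m"
        using d by (simp add: div_plus_div_distrib_dvd_left)
      with less[of b "k - b"] aligned(1) show ?thesis by (simp add: add_ac)
    next
      assume d: "m dvd v + b"
      have "(v + b) div m + (u + (k - b)) div m = (v + b + (u + (k - b))) div m"
        using d by (simp add: div_plus_div_distrib_dvd_left)
      with less[of "k - b" b] aligned(1) show ?thesis by (simp add: add_ac)
    qed
    then have "(u + v + k + m * R) div m < T"
      using assms(1) by simp
    then have "u + v + k + m * R < m * T"
      using assms(1) by (metis div_less_iff_less_mult mult.commute less_le_trans zero_less_one)
    then have total: "real u + real v + real k + real m * real R \<le> real m * real T - 1"
      unfolding of_nat_mult[symmetric] by linarith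
    then have "real k \<le> real m * real T - 1"
      using mult_nonneg_nonneg[of "real m" "real R"] by linarith
    then have "(real m - 1) / (real m * real T - 1) * real k \<le> real m - 1"
      using mT assms(1) mult_left_mono[of "real k" "real m * real T - 1" "real m - 1"] by (simp add: field_simps)
    with total show ?thesis by (simp add: algebra_simps)
  next
    case short
    \<comment> \<open>Here the units are too few to change either quotient, and each remainder is at most
      \<open>m - 1 - k\<close>.\<close>
    have "u div m + v div m + R + 1 \<le> T" using less[of 0 0] by simp
    then have "m * (u div m + v div m + R + 1) \<le> m * T" by (rule mult_le_mono2)
    then have "u + v + m * R + m + 2 * k + 2 \<le> m * T + 2 * m"
      using short mult_div_mod_eq[of m u] mult_div_mod_eq[of m v]
      unfolding distrib_left by linarith
    then have total: "real u + real v + real m * real R + 2 * real k \<le> real m * real T + real m - 2"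
      unfolding of_nat_mult[symmetric] by linarith
    have "real m \<le> real m * real T" using assms(1,2) by simp
    then have "(real m - 1) / (real m * real T - 1) \<le> 1"
      using mT by (simp add: divide_le_eq)
    then have "(real m - 1) / (real m * real T - 1) * real k \<le> 1 * real k"
      by (rule mult_right_mono) simp
    with total show ?thesis by (simp add: algebra_simps)
  qed
qed

section \<open>The weight function on the lasso\<close>

lemma consecutive_arcs_cycle_graph:
  assumes "i < length vs"
  shows "(vs ! i, vs ! (Suc i mod length vs)) \<in> parcs (cycle_graph vs)"
    "(vs ! (Suc i mod length vs), vs ! i) \<in> parcs (cycle_graph vs)"
proof -
  have "(vs ! i, vs ! (Suc i mod length vs)) \<in> set (zip vs (rotate1 vs))"
    using assms by (auto simp: in_set_zip nth_rotate1)
  then show "(vs ! i, vs ! (Suc i mod length vs)) \<in> parcs (cycle_graph vs)"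
    "(vs ! (Suc i mod length vs), vs ! i) \<in> parcs (cycle_graph vs)"
    by (auto simp: cycle_graph_def symcl_iff)
qed

lemma consecutive_arc_path_graph:
  assumes "Suc i < length vs"
  shows "(vs ! i, vs ! Suc i) \<in> parcs (path_graph vs)"
proof -
  have "(vs ! i, vs ! Suc i) \<in> set (zip vs (tl vs))"
    using assms by (auto simp: in_set_zip nth_tl)
  then show ?thesis by (simp add: path_graph_def symcl_iff)
qed

theorem lemma3:
  fixes t s :: nat
    and x x' x'' :: "nat \<Rightarrow> 'v"
    and r :: 'v
    and cyc pth :: "'v list"
    and G :: "'v pair_pre_digraph"
    and \<alpha> :: real
    and w :: "'v \<Rightarrow> real"
    and p :: "'v \<Rightarrow> nat"
  assumes "t \<ge> 2" and "s \<ge> t"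
    and cyc: "cyc = x 0 # map x' [1..<t] @ x t # rev (map x'' [1..<t])" "distinct cyc"
    and pth: "pth = map x [t..<s+1] @ [r]" "distinct pth"
    and glue: "set cyc \<inter> set pth = {x t}"
    and G: "G = graph_union (cycle_graph cyc) (path_graph pth)"
    and \<alpha>: "\<alpha> = (2 ^ s + 2 ^ (t - 1) - 2) / (2 ^ s - 1)"
    and w: "w (x 0) = \<alpha>"
      "\<And>i. 1 \<le> i \<Longrightarrow> i \<le> t - 1 \<Longrightarrow> w (x' i) = 2 ^ i"
      "\<And>i. 1 \<le> i \<Longrightarrow> i \<le> t - 1 \<Longrightarrow> w (x'' i) = 2 ^ i"
      "\<And>i. t \<le> i \<Longrightarrow> i \<le> s \<Longrightarrow> w (x i) = 2 ^ i"
      "w r = 0"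
    and p: "unsolvable G r p"
  shows "dot G w (\<lambda>v. real (p v)) \<le> dot G w (\<lambda>_. 1)"
proof -
  define h where "h = t - 1"
  define n where "n = s + 1 - t"
  have h: "0 < h" "t = Suc h" and n: "0 < n" "s = h + n"
    using assms(1,2) by (auto simp: h_def n_def)
  define a where "a i = cyc ! Suc i" for i
  \<comment> \<open>The cycle list runs back to \<open>x 0\<close> along the second arm, so that arm is read from its end.\<close>
  define b where "b i = cyc ! (2 * t - 1 - i)" for i
  define z where "z j = pth ! j" for j
  have len: "length cyc = 2 * t" "length pth = Suc n"
    using assms(1,2) by (simp_all add: cyc pth n_def del: upt_Suc)
  have a_eq: "a i = x' (Suc i)" if "i < h" for i
    using that h by (simp add: a_def cyc nth_append del: upt_Suc)
  have b_eq: "b i = x'' (Suc i)" if "i < h" for i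
  proof -
    have "cyc ! Suc (h + Suc k) = rev (map x'' [1..<t]) ! k" for k
      using h by (simp add: cyc nth_append del: upt_Suc)
    moreover have "2 * t - 1 - i = Suc (h + Suc (h - 1 - i))" using that h by simp
    ultimately have "b i = rev (map x'' [1..<t]) ! (h - 1 - i)"
      unfolding b_def by metis
    then show ?thesis
      using that h by (simp add: rev_nth del: upt_Suc)
  qed
  have z_eq: "z j = x (t + j)" if "j < n" for j
    using that by (simp add: z_def pth n_def nth_append del: upt_Suc)
  have z_n: "z n = r"
    using assms(2) by (simp add: z_def pth n_def nth_append del: upt_Suc)
  have a_h: "a h = x t"
    using h by (simp add: a_def cyc nth_append del: upt_Suc)
  have b_h: "b h = x t"
    using h by (simp add: b_def cyc nth_append del: upt_Suc)
  have c_eq: "cyc ! 0 = x 0" by (simp add: cyc)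

  have cyc_arcs: "(cyc ! i, cyc ! (Suc i mod length cyc)) \<in> parcs G"
    "(cyc ! (Suc i mod length cyc), cyc ! i) \<in> parcs G" if "i < length cyc" for i
    using consecutive_arcs_cycle_graph[OF that] by (auto simp: G graph_union_def)
  have arcs: "(x 0, a 0) \<in> parcs G" "(x 0, b 0) \<in> parcs G"
    using cyc_arcs(1)[of 0] cyc_arcs(2)[of "2 * t - 1"] assms(1) len c_eq
    by (auto simp: a_def b_def)
  have arcs_a: "(a i, a (Suc i)) \<in> parcs G" if "i < h" for i
    using cyc_arcs(1)[of "Suc i"] that len h by (simp add: a_def)
  have arcs_b: "(b i, b (Suc i)) \<in> parcs G" if "i < h" for i
  proof -
    have "Suc (2 * t - 1 - Suc i) = 2 * t - 1 - i" using that h by simp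
    then show ?thesis
      using cyc_arcs(2)[of "2 * t - 1 - Suc i"] that len h by (simp add: b_def)
  qed
  have arcs_z: "(z j, z (Suc j)) \<in> parcs G" if "j < n" for j
    using consecutive_arc_path_graph[of j pth] that len by (auto simp: z_def G graph_union_def)

  have cyc_inj: "cyc ! i = cyc ! j \<longleftrightarrow> i = j" if "i < 2 * t" "j < 2 * t" for i j
    using that len cyc(2) by (simp add: nth_eq_iff_index_eq)
  have inj: "inj_on a {..h}" "inj_on b {..h}" "inj_on z {..n}"
    using h len pth(2) by (auto simp: inj_on_def a_def b_def z_def cyc_inj nth_eq_iff_index_eq)
  have not_on_tail: "cyc ! i \<notin> z ` {..n}" if "i < 2 * t" "i \<noteq> t" for i
  proof
    assume "cyc ! i \<in> z ` {..n}"
    then have "cyc ! i \<in> set cyc \<inter> set pth"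
      using that len by (auto simp: z_def)
    then have "cyc ! i = cyc ! t"
      using glue a_h h by (simp add: a_def)
    then show False using that by (simp add: cyc_inj)
  qed
  have "a i \<notin> z ` {..n}" "b i \<notin> z ` {..n}" if "i < h" for i
    unfolding a_def b_def using that h by (intro not_on_tail; simp)+
  moreover have "a i \<noteq> b j" if "i < h" "j \<le> h" for i j
    using that h by (simp add: a_def b_def cyc_inj)
  ultimately have disj: "a ` {..<h} \<inter> b ` {..h} = {}"
    "a ` {..<h} \<inter> z ` {..n} = {}" "b ` {..<h} \<inter> z ` {..n} = {}"
    by fast+
  have c: "x 0 \<notin> a ` {..h}" "x 0 \<notin> b ` {..h}" "x 0 \<notin> z ` {..n}"
    using h not_on_tail[of 0] by (auto simp: a_def b_def cyc_inj simp flip: c_eq)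

  define U where "U = (\<Sum>i<h. 2 ^ i * p (a i))"
  define V where "V = (\<Sum>i<h. 2 ^ i * p (b i))"
  define R where "R = (\<Sum>j<n. 2 ^ j * p (z j))"
  have "(U + k) div 2 ^ h + (V + l) div 2 ^ h + R < 2 ^ n" if "k + l \<le> p (x 0) div 2" for k l
    unfolding U_def V_def R_def
    using that p a_h b_h z_eq[of 0] n h
    by (intro unsolvable_lasso[OF arcs arcs_a arcs_b arcs_z _ _ _ _ inj c disj]) (auto simp: z_n)
  moreover have "(2::nat) \<le> 2 ^ n" using n by (cases n) auto
  ultimately have key: "(1 + (real (2 ^ h) - 1) / (real (2 ^ h) * real (2 ^ n) - 1)) * real (p (x 0) div 2)
      + real U + real V + real (2 ^ h) * real R \<le> real (2 ^ h) * real (2 ^ n) + real (2 ^ h) - 2"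
    by (intro two_arms_bound) auto

  have dot_eq: "dot G w f = \<alpha> * f (x 0) + 2 * (\<Sum>i<h. 2 ^ i * f (a i)) + 2 * (\<Sum>i<h. 2 ^ i * f (b i))
      + 2 * 2 ^ h * (\<Sum>j<n. 2 ^ j * f (z j))" for f
  proof -
    have "{1..<t} = Suc ` {..<h}"
      using h by (simp add: image_Suc_lessThan atLeastLessThanSuc_atLeastAtMost)
    then have arms: "x' ` {1..<t} = a ` {..<h}" "x'' ` {1..<t} = b ` {..<h}"
      using a_eq b_eq by (auto simp: image_image)
    have "pverts G = set cyc \<union> set pth"
      by (simp add: G graph_union_def cycle_graph_def path_graph_def)
    also have "set pth = z ` {..n}"
      using len by (auto simp: z_def set_conv_nth less_Suc_eq_le)
    also have "set cyc = insert (x 0) (insert (z 0) (a ` {..<h} \<union> b ` {..<h}))"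
      using z_eq[of 0] n(1) unfolding arms[symmetric] by (simp add: cyc)
    finally have V: "pverts G = insert (x 0) (a ` {..<h} \<union> b ` {..<h} \<union> z ` {..n})"
      by auto
    let ?g = "\<lambda>v. w v * f v"
    have sub: "a ` {..<h} \<subseteq> a ` {..h}" "b ` {..<h} \<subseteq> b ` {..h}" by auto
    have "a ` {..<h} \<inter> b ` {..<h} = {}" "(a ` {..<h} \<union> b ` {..<h}) \<inter> z ` {..n} = {}"
      using Int_mono[OF order_refl sub(2), of "a ` {..<h}"] disj by (simp_all add: Int_Un_distrib2)
    moreover have "x 0 \<notin> a ` {..<h} \<union> b ` {..<h} \<union> z ` {..n}"
      using c sub by (metis Un_iff subsetD)
    ultimately have "dot G w f = ?g (x 0) + (sum ?g (a ` {..<h}) + sum ?g (b ` {..<h})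
        + sum ?g (z ` {..n}))"
      unfolding dot_def V by (simp add: sum.union_disjoint del: Un_iff image_iff)
    also have "sum ?g (a ` {..<h}) = 2 * (\<Sum>i<h. 2 ^ i * f (a i))"
      using inj(1) w(2) a_eq h
      by (subst sum.reindex) (auto simp: sum_distrib_left inj_on_def intro!: sum.cong)
    also have "sum ?g (b ` {..<h}) = 2 * (\<Sum>i<h. 2 ^ i * f (b i))"
      using inj(2) w(3) b_eq h
      by (subst sum.reindex) (auto simp: sum_distrib_left inj_on_def intro!: sum.cong)
    also have "sum ?g (z ` {..n}) = 2 * 2 ^ h * (\<Sum>j<n. 2 ^ j * f (z j))"
      using inj(3) w(4,5) z_eq z_n h n
      by (subst sum.reindex)
        (auto simp: sum_distrib_left power_add simp flip: lessThan_Suc_atMost intro!: sum.cong)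
    finally show ?thesis by (simp add: w(1))
  qed
  have pow: "(2::real) ^ s = 2 ^ h * 2 ^ n" "(2::real) \<le> 2 ^ h * 2 ^ n"
    using h n self_le_power[of "2::real" "h + n"] by (simp_all add: power_add)
  have \<alpha>_eq: "\<alpha> = 1 + (real (2 ^ h) - 1) / (real (2 ^ h) * real (2 ^ n) - 1)"
    using pow h by (simp add: \<alpha> field_simps)
  have "1 \<le> \<alpha>"
    using pow(2) by (simp add: \<alpha>_eq)
  \<comment> \<open>Only pairs of pebbles leave \<open>x 0\<close>; the weight \<open>\<alpha>\<close> of an odd one is matched by the entry of
    \<open>x 0\<close> in the all-ones vector.\<close>
  have "p (x 0) \<le> 2 * (p (x 0) div 2) + 1" by simp
  then have "\<alpha> * p (x 0) \<le> \<alpha> * (2 * real (p (x 0) div 2) + 1)"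
    using \<open>1 \<le> \<alpha>\<close> by (intro mult_left_mono) linarith+
  moreover have geom: "(\<Sum>i<m. 2 ^ i) = (2::real) ^ m - 1" for m
    using geometric_sum[of "2::real" m] by simp
  ultimately show ?thesis
    using key unfolding dot_eq \<alpha>_eq[symmetric]
    by (simp add: U_def V_def R_def geom algebra_simps)
qed

end
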